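(* For all positive integers $k,\ell$, the alternating double zeta value $\zeta(\overline{2\ell},\overline{2k})$ is given in terms of classical multiple zeta values of depth at most $2$ by \begin{align*} \zeta(\overline{2\ell},\overline{2k})={}&\sum_{i=2}^{2k+2\ell-2}2^{-i}\bigg\{\binom{i-1}{2k-1}\zeta(2k+2\ell-i,i)+\binom{i-1}{2\ell-1}\zeta(i,2k+2\ell-i)\bigg\}\\ &-\zeta(2\ell,2k)+\sum_{r=2}^{2k+2\ell-2}(-2)^{-r}\binom{r-1}{2k-1}\zeta(r)\zeta(2k+2\ell-r)\\ &-2^{-2k-2\ell}\bigg\{2\binom{2k+2\ell-2}{2k-1}+\binom{2k+2\ell-1}{2k-1}\bigg\}\zeta(2k+2\ell). \end{align*}
   Context: $\zeta(k_1,\dots,k_d)=\sum_{0<n_1<\cdots<n_d}n_1^{-k_1}\cdots n_d^{-k_d}$ for positive integers $k_i$ with $k_d\ge2$. A bar over an argument indicates an alternating sign: $\zeta(\overline{s},\overline{t})=\sum_{0<n_1<n_2}\frac{(-1)^{n_1}(-1)^{n_2}}{n_1^{s}n_2^{t}}$. $\binom nk=0$ for $k>n\ge0$. *)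

theory Defs
  imports "HOL-Analysis.Analysis"
begin

(* The multiple zeta value of the argument list [k_1, ..., k_d], with the convention
   0 < n_1 < ... < n_d, so that it is the last argument that has to be at least 2.  For positive
   arguments with last argument at least 2 the family is absolutely summable, so the unordered
   sum infsum agrees with any iterated summation.  On one-element lists this is the Riemann zeta value. *)
definition mzv :: "nat list \<Rightarrow> real" where
  "mzv ks = (\<Sum>\<^sub>\<infinity>ns\<in>{ns. length ns = length ks \<and> sorted_wrt (<) ns \<and> (\<forall>n\<in>set ns. 0 < n)}.
      \<Prod>j<length ks. 1 / real (ns ! j) ^ (ks ! j))"

(* The double zeta value with both arguments barred.  It is used only for s, t \<ge> 2, where the
   family is absolutely summable. *)
definition alt_double_zeta :: "nat \<Rightarrow> nat \<Rightarrow> real" where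
  "alt_double_zeta s t = (\<Sum>\<^sub>\<infinity>(m, n)\<in>{(m, n). 0 < m \<and> m < n}.
      ((- 1) ^ m * (- 1) ^ n) / (real m ^ s * real n ^ t))"

end

(* Since (-1)^p = 2 [p even] - 1, the alternating double zeta value plus zeta(s,t) is twice the sum of
   m^(-s) n^(-t) over m < n of equal parity, and with m = b - a, n = b + a and s even this is the
   sum of (b-a)^(-s) (b+a)^(-t) over all positive b \<noteq> a. Partial fractions with respect to
   (b-a) + (b+a) = 2b turn it into sums of b^(-i) (b+a)^(-(s+t-i)) and b^(-i) (b-a)^(-(s+t-i)). For
   i \<le> s+t-2 these are convergent double zeta values with the diagonal a = b removed, together with
   a product of zeta values from a > b. The two divergent families at i = s+t-1 have equal
   coefficients, and their combination converges because the sum over a \<noteq> b of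
   1/(b+a) + 1/(b-a) telescopes to -3/(2b). *)
theory Submission
  imports Defs
begin

section \<open>Partial fractions and a telescoping series\<close>

text \<open>With \<open>X = 1/(x+y)\<close>, \<open>Y = 1/y\<close>, \<open>W = 1/x\<close> this is the partial fraction expansion without division.\<close>

lemma partial_fraction_aux:
  fixes X Y W :: "'a :: comm_ring_1"
  assumes XYW: "W * Y = X * (W + Y)"
  shows "W ^ Suc u * Y ^ Suc v =
    (\<Sum>j\<le>u+v. of_nat (j choose u) * X ^ Suc j * Y ^ (Suc (u + v) - j))
  + (\<Sum>j\<le>u+v. of_nat (j choose v) * X ^ Suc j * W ^ (Suc (u + v) - j))"
proof -
  \<comment> \<open>The two sums of the claim are \<open>G Y u v\<close> and \<open>G W v u\<close>.
    Shifting \<open>j\<close> by one and applying Pascal's rule gives the recursions of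
    \<open>G\<close>.\<close>
  define G where "G Z u v = (\<Sum>j\<le>u+v. of_nat (j choose u) * X ^ Suc j * Z ^ (Suc (u + v) - j))"
    for Z and u v :: nat
  have G_Suc_Suc: "G Z (Suc u) (Suc v) = X * (G Z u (Suc v) + G Z (Suc u) v)" for Z u v
    unfolding G_def
    by (simp add: sum.atMost_Suc_shift sum.distrib sum_distrib_left algebra_simps del: sum.atMost_Suc)
  have G_0: "G Z 0 (Suc v) = X * (Z ^ Suc (Suc v) + G Z 0 v)" for Z v
    unfolding G_def
    by (simp add: sum.atMost_Suc_shift sum_distrib_left algebra_simps del: sum.atMost_Suc)
  \<comment> \<open>Only \<open>j = v\<close> survives, since \<open>j choose v = 0\<close> for
    smaller \<open>j\<close>.\<close>
  have G_top: "G Z v 0 = X ^ Suc v * Z" for Z v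
  proof -
    have "G Z v 0 = (\<Sum>j\<in>{v}. of_nat (j choose v) * X ^ Suc j * Z ^ (Suc v - j))"
      unfolding G_def add_0_right by (rule sum.mono_neutral_right) (auto simp: binomial_eq_0)
    then show ?thesis by simp
  qed
  have "W ^ Suc u * Y ^ Suc v = G Y u v + G W v u"
  \<comment> \<open>Each use of \<open>XYW\<close> splits the product into two products with one
    exponent lowered, matching the recursions of \<open>G\<close>; hence the nested induction on
    both exponents.\<close>
  proof (induction u arbitrary: v)
    case 0
    show ?case
    proof (induction v)
      case 0
      show ?case using XYW by (simp add: G_top algebra_simps)
    next
      case (Suc v)
      have "W ^ Suc 0 * Y ^ Suc (Suc v) = (W * Y) * Y ^ Suc v" by (simp add: algebra_simps)
      also have "\<dots> = X * (W ^ Suc 0 * Y ^ Suc v + Y ^ Suc (Suc v))"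
        unfolding XYW by (simp add: algebra_simps)
      also have "\<dots> = G Y 0 (Suc v) + G W (Suc v) 0"
        unfolding Suc.IH G_0 G_top by (simp add: algebra_simps)
      finally show ?case .
    qed
  next
    case (Suc u)
    note IHu = Suc.IH
    show ?case
    proof (induction v)
      case 0
      have "W ^ Suc (Suc u) * Y ^ Suc 0 = (W * Y) * W ^ Suc u" by (simp add: algebra_simps)
      also have "\<dots> = X * (W ^ Suc u * Y ^ Suc 0 + W ^ Suc (Suc u))"
        unfolding XYW by (simp add: algebra_simps)
      also have "\<dots> = G Y (Suc u) 0 + G W 0 (Suc u)"
        unfolding IHu G_0 G_top by (simp add: algebra_simps)
      finally show ?case .
    next
      case (Suc v)
      have "W ^ Suc (Suc u) * Y ^ Suc (Suc v) = (W * Y) * (W ^ Suc u * Y ^ Suc v)"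
        by (simp add: algebra_simps)
      also have "\<dots> = X * (W ^ Suc u * Y ^ Suc (Suc v) + W ^ Suc (Suc u) * Y ^ Suc v)"
        unfolding XYW by (simp add: algebra_simps)
      also have "\<dots> = G Y (Suc u) (Suc v) + G W (Suc v) (Suc u)"
        unfolding IHu Suc.IH G_Suc_Suc by (simp add: algebra_simps)
      finally show ?case .
    qed
  qed
  then show ?thesis
    by (simp add: G_def add.commute)
qed

lemma partial_fraction:
  fixes x y :: "'a :: field"
  assumes "x \<noteq> 0" "y \<noteq> 0" "x + y \<noteq> 0" "s \<ge> 1" "t \<ge> 1"
  shows "1 / (x ^ s * y ^ t) = (\<Sum>i = 1..s+t-1. 1 / (x + y) ^ i *
      (of_nat ((i - 1) choose (s - 1)) / y ^ (s + t - i) + of_nat ((i - 1) choose (t - 1)) / x ^ (s + t - i)))"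
proof -
  obtain u v where uv: "s = Suc u" "t = Suc v"
    using assms(4,5) by (metis Suc_le_D One_nat_def)
  have "inverse x * inverse y = inverse (x + y) * (inverse x + inverse y)"
    using assms by (simp add: field_simps)
  from partial_fraction_aux[OF this, of u v]
  have "1 / (x ^ s * y ^ t) = (\<Sum>j\<le>u+v. 1 / (x + y) ^ Suc j *
     (of_nat (j choose u) / y ^ (Suc (u + v) - j) + of_nat (j choose v) / x ^ (Suc (u + v) - j)))"
    unfolding uv by (simp add: sum.distrib distrib_left divide_inverse power_inverse mult_ac)
  also have "\<dots> = (\<Sum>i = 1..s+t-1. 1 / (x + y) ^ i *
      (of_nat ((i - 1) choose (s - 1)) / y ^ (s + t - i) + of_nat ((i - 1) choose (t - 1)) / x ^ (s + t - i)))"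
    by (rule sum.reindex_bij_witness[of _ "\<lambda>i. i - 1" Suc]) (auto simp: uv)
  finally show ?thesis .
qed

text \<open>For \<open>b > 0\<close> the term with \<open>Suc n = b\<close> contributes \<open>1/(2b)\<close>, because \<open>1/0 = 0\<close>.\<close>

lemma sums_shifted_reciprocal_difference:
  "(\<lambda>n. 1 / (real (Suc n) + real b) - 1 / (real (Suc n) - real b)) sums (- 1 / real b)"
proof (induction b)
  case 0
  show ?case by simp
next
  case (Suc b)
  \<comment> \<open>Passing from \<open>b\<close> to \<open>Suc b\<close> adds two telescoping
    series. Their sums are \<open>- 1 / (b + 1)\<close> and \<open>1 / b\<close>; the latter cancels
    the value from the induction hypothesis.\<close>
  have lim1: "(\<lambda>n. 1 / (real n + real (Suc b))) \<longlonglongrightarrow> 0" 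
    using LIMSEQ_ignore_initial_segment[OF lim_1_over_n, of "Suc b"] by (simp only: of_nat_add)
  have lim2: "(\<lambda>n. 1 / (real n - real b)) \<longlonglongrightarrow> 0" 
    by (rule LIMSEQ_offset[of _ b]) (simp add: lim_1_over_n lim_inverse_n')
  from sums_add[OF Suc.IH sums_add[OF telescope_sums[OF lim1] telescope_sums[OF lim2]]]
  show ?case
    by (simp add: algebra_simps)
qed


section \<open>Zeta values as sums over pairs of positive integers\<close>

abbreviation increasing_pairs :: "(nat \<times> nat) set" where
  "increasing_pairs \<equiv> {(m, n). 0 < m \<and> m < n}"

text \<open>Pairs are read as \<open>(b, a)\<close>. The \<open>Sigma\<close> form allows summing
  over \<open>a\<close> first for fixed \<open>b\<close>, which the boundary family
  requires.\<close>

abbreviation distinct_pairs :: "(nat \<times> nat) set" where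
  "distinct_pairs \<equiv> Sigma {0<..} (\<lambda>b. {0<..} - {b})"

lemma increasing_pairs_subset: "increasing_pairs \<subseteq> {0<..} \<times> {0<..}"
  by auto

lemma has_sum_sum:
  fixes f :: "'i \<Rightarrow> 'a \<Rightarrow> 'b :: topological_comm_monoid_add"
  assumes "\<And>i. i \<in> I \<Longrightarrow> (f i has_sum S i) A"
  shows "((\<lambda>x. \<Sum>i\<in>I. f i x) has_sum (\<Sum>i\<in>I. S i)) A"
  using assms by (induction I rule: infinite_finite_induct) (auto intro!: has_sum_add)

lemma summable_on_inverse_power:
  assumes "r \<ge> 2"
  shows "(\<lambda>n. 1 / real n ^ r) summable_on A"
proof -
  have "(\<lambda>n. 1 / real n ^ r) summable_on UNIV"
    using inverse_power_summable[OF assms, where 'a = real]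
    by (subst summable_on_UNIV_nonneg_real_iff) (auto simp: field_simps)
  then show ?thesis
    by (rule summable_on_subset_banach) simp
qed

lemma has_sum_mzv1:
  assumes "r \<ge> 2"
  shows "((\<lambda>n. 1 / real n ^ r) has_sum mzv [r]) {0<..}"
proof -
  have "mzv [r] = infsum (\<lambda>n. 1 / real n ^ r) {0<..}"
    unfolding mzv_def
    by (rule infsum_reindex_bij_witness[of _ "\<lambda>n. [n]" hd]) (auto simp: length_Suc_conv)
  then show ?thesis
    using summable_on_inverse_power[OF assms] by simp
qed

text \<open>The double sum factors. By restriction it is also the source of summability on every
  smaller set of pairs.\<close>

lemma has_sum_product_inverse_powers:
  assumes "i \<ge> 2" "j \<ge> 2"
  shows "((\<lambda>(m, n). 1 / (real m ^ i * real n ^ j)) has_sum (mzv [i] * mzv [j])) ({0<..} \<times> {0<..})"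
proof -
  have inner: "((\<lambda>n. case (m, n) of (m, n) \<Rightarrow> 1 / (real m ^ i * real n ^ j))
      has_sum (1 / real m ^ i * mzv [j])) {0<..}" for m
    using has_sum_cmult_right[OF has_sum_mzv1[OF assms(2)], of "1 / real m ^ i"] by simp
  have outer: "((\<lambda>m. 1 / real m ^ i * mzv [j]) has_sum (mzv [i] * mzv [j])) {0<..}"
    by (rule has_sum_cmult_left[OF has_sum_mzv1[OF assms(1)]])
  show ?thesis
    by (rule has_sum_SigmaI[OF inner outer], rule summable_on_SigmaI[OF inner])
      (use outer in \<open>auto simp: summable_on_def\<close>)
qed

lemma summable_on_inverse_powers:
  assumes "i \<ge> 2" "j \<ge> 2" "A \<subseteq> {0<..} \<times> {0<..}"
  shows "(\<lambda>(m, n). 1 / (real m ^ i * real n ^ j)) summable_on A"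
  by (rule summable_on_subset_banach[OF has_sum_imp_summable[OF has_sum_product_inverse_powers]])
    (use assms in auto)

lemma has_sum_mzv2:
  assumes "s \<ge> 2" "t \<ge> 2"
  shows "((\<lambda>(m, n). 1 / (real m ^ s * real n ^ t)) has_sum mzv [s, t]) increasing_pairs"
proof -
  have "mzv [s, t] = infsum (\<lambda>(m, n). 1 / (real m ^ s * real n ^ t)) increasing_pairs"
    unfolding mzv_def
    by (rule infsum_reindex_bij_witness[of _ "\<lambda>(m, n). [m, n]" "\<lambda>ns. (ns ! 0, ns ! 1)"])
      (auto simp: length_Suc_conv lessThan_Suc)
  then show ?thesis
    using summable_on_inverse_powers[OF assms increasing_pairs_subset] by simp
qed

lemma has_sum_alt_double_zeta:
  assumes "s \<ge> 2" "t \<ge> 2"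
  shows "((\<lambda>(m, n). ((- 1) ^ m * (- 1) ^ n) / (real m ^ s * real n ^ t)) has_sum alt_double_zeta s t)
    increasing_pairs"
proof -
  have "(\<lambda>(m, n). norm (((- 1) ^ m * (- 1) ^ n) / (real m ^ s * real n ^ t))) summable_on increasing_pairs"
    using summable_on_inverse_powers[OF assms increasing_pairs_subset]
    by (simp add: abs_mult power_abs)
  then have "(\<lambda>(m, n). ((- 1) ^ m * (- 1) ^ n) / (real m ^ s * real n ^ t)) summable_on increasing_pairs"
    by (rule abs_summable_summable[OF summable_on_cong[THEN iffD1, rotated]]) auto
  then show ?thesis
    unfolding alt_double_zeta_def by simp
qed

section \<open>Sums over pairs of distinct positive integers\<close>

lemma distinct_pairs_split:
  "distinct_pairs = increasing_pairs \<union> prod.swap ` increasing_pairs"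
  "increasing_pairs \<inter> prod.swap ` increasing_pairs = {}"
  by force+

lemma has_sum_distinct_pairs:
  fixes f :: "nat \<times> nat \<Rightarrow> real"
  assumes "(f has_sum A) increasing_pairs" "((f \<circ> prod.swap) has_sum B) increasing_pairs"
  shows "(f has_sum (A + B)) distinct_pairs"
proof -
  have "(f has_sum B) (prod.swap ` increasing_pairs)"
    using assms(2) by (subst has_sum_reindex) auto
  from has_sum_Un_disjoint[OF assms(1) this distinct_pairs_split(2)] show ?thesis
    by (simp only: distinct_pairs_split(1))
qed

text \<open>Sign cancellation leaves twice the pairs of equal parity, and the substitution carries
  these to \<open>a < b\<close>. The factor 2 is then absorbed by also counting the mirrored pairs
  \<open>a > b\<close>, whose terms agree because \<open>s\<close> is even.\<close>

lemma has_sum_alt_double_zeta_plus_mzv: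
  assumes "s \<ge> 2" "t \<ge> 2" "even s"
  shows "((\<lambda>(b, a). 1 / ((real b - real a) ^ s * (real b + real a) ^ t))
    has_sum (alt_double_zeta s t + mzv [s, t])) distinct_pairs"
proof -
  define S where "S = alt_double_zeta s t + mzv [s, t]"
  define f where "f = (\<lambda>(b, a). 1 / ((real b - real a) ^ s * (real b + real a) ^ t))"
  have "((\<lambda>(m, n). if even (m + n) then 2 * (1 / (real m ^ s * real n ^ t)) else 0) has_sum S) increasing_pairs"
    using has_sum_add[OF has_sum_alt_double_zeta[OF assms(1,2)] has_sum_mzv2[OF assms(1,2)]]
    unfolding S_def
    by (rule has_sum_cong[THEN iffD1, rotated]) (auto simp: add_divide_distrib minus_one_power_iff)
  then have "((\<lambda>(m, n). 2 * (1 / (real m ^ s * real n ^ t))) has_sum S)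
      {(m, n). 0 < m \<and> m < n \<and> even (m + n)}"
    by (rule has_sum_cong_neutral[THEN iffD1, rotated -1]) (auto split: if_splits)
  then have "((\<lambda>(m, n). 1 / (real m ^ s * real n ^ t)) has_sum (S / 2))
      {(m, n). 0 < m \<and> m < n \<and> even (m + n)}"
    by (subst (asm) has_sum_cong[of _ _ "\<lambda>x. 2 * (case x of (m, n) \<Rightarrow> 1 / (real m ^ s * real n ^ t))"])
      (auto simp: has_sum_cmult_right_iff)
  \<comment> \<open>The inverse takes half the difference and half the sum, which are integers
    exactly for equal parity.\<close>
  moreover have "bij_betw (\<lambda>(a, b). (b - a, b + a)) increasing_pairs {(m, n). 0 < m \<and> m < n \<and> even (m + n)}"
  proof (rule bij_betw_imageI)
    show "inj_on (\<lambda>(a, b). (b - a, b + a)) increasing_pairs"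
      by (auto simp: inj_on_def)
    show "(\<lambda>(a, b). (b - a, b + a)) ` increasing_pairs = {(m, n). 0 < m \<and> m < n \<and> even (m + n)}"
    proof safe
      fix m n :: nat
      assume mn: "0 < m" "m < n" "even (m + n)"
      then have "even (n - m)"
        by simp
      then obtain d where "n - m = 2 * d"
        by (rule evenE)
      with mn show "(m, n) \<in> (\<lambda>(a, b). (b - a, b + a)) ` increasing_pairs"
        by (intro image_eqI[of _ _ "(d, m + d)"]) auto
    qed auto
  qed
  ultimately have "((\<lambda>x. case (case x of (a, b) \<Rightarrow> (b - a, b + a)) of (m, n) \<Rightarrow> 1 / (real m ^ s * real n ^ t))
      has_sum (S / 2)) increasing_pairs"
    by (subst has_sum_reindex_bij_betw)
  then have *: "((f \<circ> prod.swap) has_sum (S / 2)) increasing_pairs"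
    by (rule has_sum_cong[THEN iffD1, rotated]) (auto simp: f_def of_nat_diff)
  have even_swap: "(real a - real b) ^ s = (real b - real a) ^ s" for a b
    using power_minus_even[OF \<open>even s\<close>, of "real b - real a"] by simp
  have "(f has_sum (S / 2)) increasing_pairs"
    using * by (rule has_sum_cong[THEN iffD1, rotated]) (auto simp: f_def add.commute even_swap)
  from has_sum_distinct_pairs[OF this *] show ?thesis
    by (simp add: S_def f_def)
qed

text \<open>Setting \<open>n = b + a\<close> turns the sum over all positive \<open>a\<close>,
  \<open>b\<close> into \<open>mzv [i, j]\<close>; the diagonal \<open>a = b\<close> contributes
  \<open>1 / (b ^ i * (2 * b) ^ j)\<close> and is subtracted.\<close>

lemma has_sum_distinct_pairs_plus:
  assumes "i \<ge> 2" "j \<ge> 2"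
  shows "((\<lambda>(b, a). 1 / (real b ^ i * (real b + real a) ^ j))
    has_sum (mzv [i, j] - 1 / 2 ^ j * mzv [i + j])) distinct_pairs"
proof -
  let ?f = "\<lambda>(b, a). 1 / (real b ^ i * (real b + real a) ^ j)"
  have 1: "(?f has_sum mzv [i, j]) ({0<..} \<times> {0<..})"
    using has_sum_mzv2[OF assms]
    by (rule has_sum_reindex_bij_witness[of _ "\<lambda>(m, n). (m, n - m)"
          "\<lambda>(b, a). (b, b + a)", THEN iffD2, rotated -1]) auto
  have "((\<lambda>n. 1 / 2 ^ j * (1 / real n ^ (i + j))) has_sum (1 / 2 ^ j * mzv [i + j])) {0<..}"
    by (rule has_sum_cmult_right[OF has_sum_mzv1]) (use assms in simp)
  then have 2: "(?f has_sum (1 / 2 ^ j * mzv [i + j])) ((\<lambda>n. (n, n)) ` {0<..})"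
    by (subst has_sum_reindex) (auto simp: inj_on_def o_def power_add power_mult_distrib mult_ac simp flip: mult_2)
  have "{0<..} \<times> {0<..} - (\<lambda>n. (n, n)) ` {0<..} = distinct_pairs"
    by auto
  with has_sum_Diff[OF 1 2] show ?thesis
    by auto
qed

text \<open>For \<open>a < b\<close> the difference \<open>b - a\<close> is a positive integer below
  \<open>b\<close>, which gives \<open>mzv [j, i]\<close>. For \<open>a > b\<close> the numbers
  \<open>b\<close> and \<open>a - b\<close> range independently over the positive integers, which
  gives the signed product.\<close>

lemma has_sum_distinct_pairs_minus:
  assumes "i \<ge> 2" "j \<ge> 2"
  shows "((\<lambda>(b, a). 1 / (real b ^ i * (real b - real a) ^ j))
    has_sum (mzv [j, i] + (- 1) ^ j * mzv [i] * mzv [j])) distinct_pairs"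
proof -
  let ?f = "\<lambda>(b, a). 1 / (real b ^ i * (real b - real a) ^ j)"
  have 1: "((?f \<circ> prod.swap) has_sum mzv [j, i]) increasing_pairs"
    using has_sum_mzv2[OF assms(2,1)]
    by (rule has_sum_reindex_bij_witness[of _ "\<lambda>(m, n). (n - m, n)"
          "\<lambda>(a, b). (b - a, b)", THEN iffD2, rotated -1]) (auto simp: of_nat_diff)
  have "((\<lambda>x. (- 1) ^ j * (case x of (m, n) \<Rightarrow> 1 / (real m ^ i * real n ^ j)))
      has_sum ((- 1) ^ j * (mzv [i] * mzv [j]))) ({0<..} \<times> {0<..})"
    by (rule has_sum_cmult_right[OF has_sum_product_inverse_powers[OF assms]])
  then have "((\<lambda>(m, n). 1 / (real m ^ i * (- real n) ^ j)) has_sum ((- 1) ^ j * (mzv [i] * mzv [j])))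
      ({0<..} \<times> {0<..})"
    by (rule has_sum_cong[THEN iffD1, rotated]) (auto simp: minus_one_power_iff)
  then have 2: "(?f has_sum ((- 1) ^ j * (mzv [i] * mzv [j]))) increasing_pairs"
    by (rule has_sum_reindex_bij_witness[of _ "\<lambda>(b, c). (b, b + c)"
          "\<lambda>(b, a). (b, a - b)", THEN iffD2, rotated -1]) (auto simp: of_nat_diff)
  from has_sum_distinct_pairs[OF 2 1] show ?thesis
    by (simp add: algebra_simps)
qed

text \<open>The two reciprocals are kept together because each alone diverges when summed over
  \<open>a\<close>. Existence of \<open>S\<close> is supplied later by a difference of convergent
  families; it permits summing over \<open>a\<close> first, where the inner sums telescope.\<close>

lemma has_sum_distinct_pairs_boundary:
  assumes r: "r \<ge> 1"
    and S: "((\<lambda>(b, a). 1 / real b ^ r * (1 / (real b + real a) + 1 / (real b - real a))) has_sum S) distinct_pairs"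
  shows "S = - 3 / 2 * mzv [Suc r]"
proof -
  have inner: "((\<lambda>a. 1 / real b ^ r * (1 / (real b + real a) + 1 / (real b - real a)))
      has_sum (- 3 / 2 * (1 / real b ^ Suc r))) ({0<..} - {b})" if b: "b \<in> {0<..}" for b
  proof -
    define h where "h a = 1 / (real b + real a) + 1 / (real b - real a)" for a
    have "(\<lambda>a. 1 / real b ^ r * h a) summable_on ({0<..} - {b})"
      using summable_on_SigmaD1[OF has_sum_imp_summable[OF S] b] by (simp add: h_def)
    then have "h summable_on ({0<..} - {b})"
      using b by (subst (asm) summable_on_cmult_right') auto
    then obtain T where T: "(h has_sum T) ({0<..} - {b})"
      by (auto simp: summable_on_def)
    \<comment> \<open>Reinserting \<open>a = b\<close> makes the index set all positive integers, as
      the telescoping series requires. There \<open>h b = 1 / (2 * b)\<close> because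
      \<open>1 / 0 = 0\<close>; removing it turns \<open>- 1 / b\<close> into
      \<open>- 3 / (2 * b)\<close>.\<close>
    have "(h has_sum (h b + T)) (insert b ({0<..} - {b}))"
      using T by (intro has_sum_insert) auto
    also have "insert b ({0<..} - {b}) = range Suc"
      using b by (auto simp: greaterThan_0)
    finally have "(\<lambda>n. h (Suc n)) sums (h b + T)"
      by (subst (asm) has_sum_reindex) (auto simp: o_def intro: has_sum_imp_sums)
    moreover have "(\<lambda>n. h (Suc n)) sums (- 1 / real b)"
    proof -
      have "h (Suc n) = 1 / (real (Suc n) + real b) - 1 / (real (Suc n) - real b)" for n
        unfolding h_def
        by (metis add.commute diff_conv_add_uminus divide_minus_right minus_diff_eq)
      then show ?thesis
        using sums_shifted_reciprocal_difference[of b] by presburger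
    qed
    ultimately have "h b + T = - 1 / real b"
      by (rule sums_unique2)
    moreover have "h b = 1 / (2 * real b)"
      by (simp add: h_def)
    ultimately have "T = - 3 / 2 * (1 / real b)"
      by simp
    with has_sum_cmult_right[OF T, of "1 / real b ^ r"] show ?thesis
      by (simp add: h_def mult_ac)
  qed
  have "((\<lambda>b. - 3 / 2 * (1 / real b ^ Suc r)) has_sum S) {0<..}"
    by (rule has_sum_SigmaD[OF S]) (use inner in simp)
  moreover have "((\<lambda>b. - 3 / 2 * (1 / real b ^ Suc r)) has_sum (- 3 / 2 * mzv [Suc r])) {0<..}"
    using r by (intro has_sum_cmult_right has_sum_mzv1) simp
  ultimately show ?thesis
    by (rule has_sum_unique)
qed

section \<open>Assembling the formula\<close>

lemma sum_binomial_shifted: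
  assumes "s \<ge> 2" "t \<ge> 2"
  shows "(\<Sum>i = 2..s+t-2. (i - 1) choose (s - 1)) = (s + t - 2) choose s"
proof -
  obtain u v where uv: "s = Suc (Suc u)" "t = Suc (Suc v)"
    using assms by (intro that[of "s - 2" "t - 2"]) auto
  have "(\<Sum>i = 2..s+t-2. (i - 1) choose (s - 1)) = (\<Sum>i = 1..u+v+1. i choose Suc u)"
    by (rule sum.reindex_bij_witness[of _ Suc "\<lambda>i. i - 1"]) (auto simp: uv)
  \<comment> \<open>The added term is \<open>0 choose Suc u = 0\<close>; the hockey-stick identity
    then applies.\<close>
  also have "\<dots> = (\<Sum>i = 0..u+v+1. i choose Suc u)"
    by (rule sum.mono_neutral_left) (auto simp: not_less_eq_eq)
  also have "\<dots> = (s + t - 2) choose s"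
    using sum_choose_upper[of "Suc u" "u + v + 1"] by (simp add: uv atLeast0AtMost)
  finally show ?thesis .
qed

text \<open>Partial fractions are summed family by family for
  \<open>2 \<le> i \<le> s + t - 2\<close>. What remains is a multiple of the boundary family; it is
  summable as a difference of summable families, and its value is the last term.\<close>

lemma alt_double_zeta_eq:
  assumes s: "s \<ge> 2" "even s" and t: "t \<ge> 2"
  shows "alt_double_zeta s t + mzv [s, t] =
    (\<Sum>i = 2..s+t-2. 1 / 2 ^ i *
      (real ((i - 1) choose (s - 1)) * (mzv [i, s + t - i] - 1 / 2 ^ (s + t - i) * mzv [s + t])
     + real ((i - 1) choose (t - 1)) * (mzv [s + t - i, i] + (- 1) ^ (s + t - i) * mzv [i] * mzv [s + t - i])))
    - 3 / 2 ^ (s + t) * real ((s + t - 2) choose (s - 1)) * mzv [s + t]"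
    (is "?L = ?R - _")
proof -
  define w where "w = s + t"
  \<comment> \<open>The coefficient shared by both terms at \<open>i = w - 1\<close>: since
    \<open>s - 1\<close> and \<open>t - 1\<close> add up to \<open>w - 2\<close>, the two binomials
    agree. It is nonzero and can be divided out.\<close>
  define c where "c = 1 / 2 ^ (w - 1) * real ((w - 2) choose (s - 1))"
  define f where "f = (\<lambda>(b, a). 1 / ((real b - real a) ^ s * (real b + real a) ^ t))"
  define p where "p i x = (case x of (b, a) \<Rightarrow> 1 / (real b ^ i * (real b + real a) ^ (w - i)))"
    for i :: nat and x :: "nat \<times> nat"
  define m where "m i x = (case x of (b, a) \<Rightarrow> 1 / (real b ^ i * (real b - real a) ^ (w - i)))"
    for i :: nat and x :: "nat \<times> nat"
  define g where "g i x = 1 / 2 ^ i * (real ((i - 1) choose (s - 1)) * p i x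
      + real ((i - 1) choose (t - 1)) * m i x)" for i x
  have w: "w \<ge> 4" "c \<noteq> 0"
    using s t by (auto simp: w_def c_def)
  have "(g i has_sum 1 / 2 ^ i *
      (real ((i - 1) choose (s - 1)) * (mzv [i, w - i] - 1 / 2 ^ (w - i) * mzv [w])
     + real ((i - 1) choose (t - 1)) * (mzv [w - i, i] + (- 1) ^ (w - i) * mzv [i] * mzv [w - i])))
     distinct_pairs" if "i \<in> {2..w-2}" for i
    unfolding g_def p_def m_def
    using that has_sum_distinct_pairs_plus[of i "w - i"] has_sum_distinct_pairs_minus[of i "w - i"]
    by (intro has_sum_cmult_right has_sum_add) auto
  then have G: "((\<lambda>x. \<Sum>i = 2..w-2. g i x) has_sum ?R) distinct_pairs"
    unfolding w_def by (rule has_sum_sum)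
  have F: "f x - (\<Sum>i = 2..w-2. g i x) =
      c * (case x of (b, a) \<Rightarrow> 1 / real b ^ (w - 1) * (1 / (real b + real a) + 1 / (real b - real a)))"
    if "x \<in> distinct_pairs" for x
  proof -
    obtain b a where x: "x = (b, a)" by (cases x)
    from that have ab: "0 < a" "0 < b" "a \<noteq> b" by (auto simp: x)
    have "f x = (\<Sum>i = 1..w-1. 1 / (2 * real b) ^ i * (real ((i - 1) choose (s - 1)) / (real b + real a) ^ (w - i)
        + real ((i - 1) choose (t - 1)) / (real b - real a) ^ (w - i)))"
      using partial_fraction[of "real b - real a" "real b + real a" s t] ab s t
      by (simp add: f_def x w_def)
    also have "\<dots> = (\<Sum>i = 1..w-1. g i x)"
      by (simp add: g_def p_def m_def x power_mult_distrib algebra_simps)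
    also have "{1..w-1} = insert 1 (insert (w - 1) {2..w-2})"
      using w by auto
    also have "(\<Sum>i\<in>\<dots>. g i x) = g 1 x + g (w - 1) x + (\<Sum>i = 2..w-2. g i x)"
    proof -
      have "1 \<notin> insert (w - 1) {2..w-2}" "w - 1 \<notin> {2..w-2}"
        using w by auto
      then show ?thesis
        by (subst sum.insert sum.insert; simp)
    qed
    \<comment> \<open>Both binomials are \<open>0\<close> over a positive lower index, as
      \<open>s\<close> and \<open>t\<close> are at least 2.\<close>
    also have "g 1 x = 0"
      using s t by (simp add: g_def binomial_eq_0)
    also have "(w - 2) choose (t - 1) = (w - 2) choose (s - 1)"
      using s t binomial_symmetric[of "t - 1" "w - 2"] by (simp add: w_def)
    then have "g (w - 1) x = c * (1 / real b ^ (w - 1) * (1 / (real b + real a) + 1 / (real b - real a)))"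
      using w by (simp add: g_def p_def m_def x c_def algebra_simps numeral_2_eq_2)
    finally show ?thesis
      by (simp add: x)
  qed
  have "((\<lambda>x. f x - (\<Sum>i = 2..w-2. g i x)) has_sum (?L - ?R)) distinct_pairs"
    using has_sum_add[OF has_sum_alt_double_zeta_plus_mzv[OF s(1) t s(2)] has_sum_uminusI[OF G]]
    unfolding f_def by simp
  then have "((\<lambda>x. c * (case x of (b, a) \<Rightarrow> 1 / real b ^ (w - 1) * (1 / (real b + real a) + 1 / (real b - real a))))
      has_sum (?L - ?R)) distinct_pairs"
    by (rule has_sum_cong[THEN iffD1, rotated]) (rule F)
  then have "((\<lambda>(b, a). 1 / real b ^ (w - 1) * (1 / (real b + real a) + 1 / (real b - real a)))
      has_sum ((?L - ?R) / c)) distinct_pairs"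
    using w by (simp add: has_sum_cmult_right_iff)
  from has_sum_distinct_pairs_boundary[OF _ this] w
  have "?L - ?R = c * (- 3 / 2 * mzv [w])"
    by (simp add: field_simps)
  \<comment> \<open>The denominator of \<open>3 / 2\<close> raises \<open>2 ^ (w - 1)\<close> to
    \<open>2 ^ w\<close>.\<close>
  moreover have "c * (- 3 / 2 * mzv [w]) = - (3 / 2 ^ w * real ((w - 2) choose (s - 1)) * mzv [w])"
    using w power_Suc[of "2::real" "w - 1"] by (simp add: c_def)
  ultimately show ?thesis
    unfolding w_def by linarith
qed

theorem propositionA3:
  fixes k l :: nat
  assumes "k \<ge> 1" and "l \<ge> 1"
  shows "alt_double_zeta (2 * l) (2 * k) =
    (\<Sum>i = 2..2 * k + 2 * l - 2. 1 / 2 ^ i *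
        (real ((i - 1) choose (2 * k - 1)) * mzv [2 * k + 2 * l - i, i]
         + real ((i - 1) choose (2 * l - 1)) * mzv [i, 2 * k + 2 * l - i]))
    - mzv [2 * l, 2 * k]
    + (\<Sum>r = 2..2 * k + 2 * l - 2. 1 / (- 2) ^ r * real ((r - 1) choose (2 * k - 1))
        * mzv [r] * mzv [2 * k + 2 * l - r])
    - 1 / 2 ^ (2 * k + 2 * l) *
        (2 * real ((2 * k + 2 * l - 2) choose (2 * k - 1))
         + real ((2 * k + 2 * l - 1) choose (2 * k - 1))) * mzv [2 * k + 2 * l]"
proof -
  define s t w where "s = 2 * l" and "t = 2 * k" and "w = t + s"
  have st: "s \<ge> 2" "even s" "t \<ge> 2" "even w"
    using assms by (auto simp: s_def t_def w_def)
  \<comment> \<open>\<open>A\<close> and \<open>B\<close> are the summands of the two sums in the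
    claim; the removed diagonals and the boundary family leave only multiples of
    \<open>mzv [w]\<close>.\<close>
  define A where "A i = 1 / 2 ^ i * (real ((i - 1) choose (t - 1)) * mzv [w - i, i]
      + real ((i - 1) choose (s - 1)) * mzv [i, w - i])" for i
  define B where "B r = 1 / (- 2) ^ r * real ((r - 1) choose (t - 1)) * mzv [r] * mzv [w - r]" for r
  have "alt_double_zeta s t + mzv [s, t] =
     (\<Sum>i = 2..w-2. A i + B i - 1 / 2 ^ w * mzv [w] * real ((i - 1) choose (s - 1)))
     - 3 / 2 ^ w * real ((w - 2) choose (s - 1)) * mzv [w]"
  proof -
    have "1 / 2 ^ i *
      (real ((i - 1) choose (s - 1)) * (mzv [i, w - i] - 1 / 2 ^ (w - i) * mzv [w])
     + real ((i - 1) choose (t - 1)) * (mzv [w - i, i] + (- 1) ^ (w - i) * mzv [i] * mzv [w - i]))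
     = A i + B i - 1 / 2 ^ w * mzv [w] * real ((i - 1) choose (s - 1))" if "i \<in> {2..w-2}" for i
    proof -
      have "i \<le> w" using that by auto
      have weight: "1 / 2 ^ w = 1 / 2 ^ i * (1 / 2 ^ (w - i) :: real)"
        using \<open>i \<le> w\<close> by (simp flip: power_add)
      \<comment> \<open>Since \<open>w\<close> is even, \<open>w - i\<close> and \<open>i\<close>
        have the same parity, so the sign merges with \<open>1 / 2 ^ i\<close> into
        \<open>1 / (- 2) ^ i\<close>.\<close>
      have sign: "(- 1) ^ (w - i) = ((- 1) ^ i :: real)"
        using \<open>i \<le> w\<close> \<open>even w\<close> by (simp add: minus_one_power_iff)
      have minus_two: "1 / (- 2) ^ i = 1 / 2 ^ i * ((- 1) ^ i :: real)"
        by (simp add: minus_one_power_iff)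
      show ?thesis
        unfolding A_def B_def weight sign minus_two by (simp only: algebra_simps)
    qed
    then show ?thesis
      using alt_double_zeta_eq[OF st(1-3)] by (simp add: w_def add.commute)
  qed
  also have "\<dots> = (\<Sum>i = 2..w-2. A i) + (\<Sum>i = 2..w-2. B i)
      - 1 / 2 ^ w * (real (\<Sum>i = 2..w-2. (i - 1) choose (s - 1)) + 3 * real ((w - 2) choose (s - 1))) * mzv [w]"
    unfolding sum_subtractf sum.distrib sum_distrib_left[symmetric] of_nat_sum
    by (simp add: algebra_simps)
  \<comment> \<open>Every removed diagonal carries the same power \<open>1 / 2 ^ w\<close>, so only
    the binomials have to be added up.\<close>
  also have "(\<Sum>i = 2..w-2. (i - 1) choose (s - 1)) = (w - 2) choose s"
    using sum_binomial_shifted[OF st(1,3)] by (simp add: w_def add.commute)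
  also have "(w - 2) choose s = (w - 2) choose (t - 2)"
    using st binomial_symmetric[of s "w - 2"] by (simp add: w_def)
  also have "(w - 2) choose (s - 1) = (w - 2) choose (t - 1)"
    using st binomial_symmetric[of "s - 1" "w - 2"] by (simp add: w_def)
  \<comment> \<open>Pascal's rule merges the first binomial with one of the three copies of the
    second.\<close>
  also have "real ((w - 2) choose (t - 2)) + 3 * real ((w - 2) choose (t - 1))
      = 2 * real ((w - 2) choose (t - 1)) + real ((w - 1) choose (t - 1))"
    using st binomial_Suc_Suc[of "w - 2" "t - 2"] by (simp add: w_def Suc_diff_Suc numeral_2_eq_2)
  finally show ?thesis
    by (simp add: A_def B_def w_def s_def t_def)
qed

end
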